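(* Let $U\colon [0,1]^2\to[0,1]$ be a uninorm with $U\in\mathcal{U}$. Then there exists a symmetric, surjective, non-increasing set-valued function $r$ on $[0,1]$ such that $U$ is continuous on $[0,1]^2\setminus R$, where $R=G(r)$ is the graph of $r$. (It is not claimed that $U$ is non-continuous at every point of $R$.)
   Context: A uninorm is a function $U\colon[0,1]^2\to[0,1]$ which is commutative, associative, non-decreasing (not necessarily strictly) in both variables and has a neutral element $e\in(0,1)$, i.e. $U(e,x)=x$ for all $x\in[0,1]$. For a uninorm $U$ with neutral element $e$, its underlying t-norm and t-conorm are $T_U(x,y)=\frac{1}{e}U(ex,ey)$ and $S_U(x,y)=\frac{U(e+(1-e)x,\,e+(1-e)y)-e}{1-e}$ for $x,y\in[0,1]$. $\mathcal{U}$ denotes the set of all uninorms $U$ such that both $T_U$ and $S_U$ are continuous on $[0,1]^2$. "$U$ is continuous on a set $M\subseteq[0,1]^2$" means that $U$, as a function on $[0,1]^2$, is continuous at every point of $M$. A set-valued function on $[0,1]$ is a mapping $p\colon[0,1]\to\mathcal{P}([0,1])$. It is non-increasing if for all $x_1<x_2$ in $[0,1]$ we have $y_1\ge y_2$ for all $y_1\in p(x_1)$ and all $y_2\in p(x_2)$; symmetric if $y\in p(x)$ if and only if $x\in p(y)$; surjective if for every $y\in[0,1]$ there is an $x\in[0,1]$ with $y\in p(x)$. Its graph is $G(p)=\{(x,y)\in[0,1]^2\mid y\in p(x)\}$. *)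

theory Defs
  imports "HOL-Analysis.Analysis"
begin

abbreviation unit_square :: "(real \<times> real) set" where
  "unit_square \<equiv> {0..1} \<times> {0..1}"

text \<open>
  A function on the unit square is a curried function on all of \<open>real\<close>; only its values
  on the unit square are constrained or used.
\<close>

definition uninorm_with :: "(real \<Rightarrow> real \<Rightarrow> real) \<Rightarrow> real \<Rightarrow> bool" where
  "uninorm_with U e \<longleftrightarrow>
     (\<forall>x\<in>{0..1}. \<forall>y\<in>{0..1}. U x y \<in> {0..1}) \<and>
     (\<forall>x\<in>{0..1}. \<forall>y\<in>{0..1}. U x y = U y x) \<and>
     (\<forall>x\<in>{0..1}. \<forall>y\<in>{0..1}. \<forall>z\<in>{0..1}. U (U x y) z = U x (U y z)) \<and>
     (\<forall>x\<in>{0..1}. mono_on {0..1} (\<lambda>y. U x y)) \<and>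
     (\<forall>y\<in>{0..1}. mono_on {0..1} (\<lambda>x. U x y)) \<and>
     e \<in> {0<..<1} \<and>
     (\<forall>x\<in>{0..1}. U e x = x)"

definition uninorm :: "(real \<Rightarrow> real \<Rightarrow> real) \<Rightarrow> bool" where
  "uninorm U \<longleftrightarrow> (\<exists>e. uninorm_with U e)"

lemma uninorm_with_unique:
  assumes "uninorm_with U e" and "uninorm_with U e'"
  shows "e = e'"
proof -
  have e: "e \<in> {0..1}" and e': "e' \<in> {0..1}"
    using assms by (auto simp: uninorm_with_def)
  have "e' = U e e'" using assms(1) e' unfolding uninorm_with_def by metis
  also have "\<dots> = U e' e" using assms(1) e e' unfolding uninorm_with_def by blast
  also have "\<dots> = e" using assms(2) e unfolding uninorm_with_def by metis
  finally show ?thesis by simp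
qed

definition underlying_tnorm :: "(real \<Rightarrow> real \<Rightarrow> real) \<Rightarrow> real \<Rightarrow> real \<Rightarrow> real \<Rightarrow> real" where
  "underlying_tnorm U e x y = 1 / e * U (e * x) (e * y)"

definition underlying_tconorm :: "(real \<Rightarrow> real \<Rightarrow> real) \<Rightarrow> real \<Rightarrow> real \<Rightarrow> real \<Rightarrow> real" where
  "underlying_tconorm U e x y = (U (e + (1 - e) * x) (e + (1 - e) * y) - e) / (1 - e)"

text \<open>
  The class of uninorms with continuous underlying operations.  The existential quantifier
  over \<open>e\<close> is harmless, since the neutral element is unique by
  \<open>uninorm_with_unique\<close>.
\<close>

definition uninorms_cont_underlying :: "(real \<Rightarrow> real \<Rightarrow> real) set" where
  "uninorms_cont_underlying =
     {U. \<exists>e. uninorm_with U e \<and>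
       continuous_on unit_square (\<lambda>(x, y). underlying_tnorm U e x y) \<and>
       continuous_on unit_square (\<lambda>(x, y). underlying_tconorm U e x y)}"

text \<open>
  Continuity at every point of \<open>M\<close> as a function on the whole unit square.  This is
  stronger than continuity of the restriction to \<open>M\<close>, i.e. than \<open>continuous_on M\<close>.
\<close>

definition continuous_at_points_of :: "(real \<times> real) set \<Rightarrow> (real \<Rightarrow> real \<Rightarrow> real) \<Rightarrow> bool" where
  "continuous_at_points_of M U \<longleftrightarrow>
     (\<forall>p\<in>M. continuous (at p within unit_square) (\<lambda>(x, y). U x y))"

text \<open>
  Set-valued functions on the unit interval; their values at other arguments are irrelevant.
  The empty set is admitted as a value.
\<close>

definition set_valued_function :: "(real \<Rightarrow> real set) \<Rightarrow> bool" where
  "set_valued_function p \<longleftrightarrow> (\<forall>x\<in>{0..1}. p x \<subseteq> {0..1})"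

definition sv_nonincreasing :: "(real \<Rightarrow> real set) \<Rightarrow> bool" where
  "sv_nonincreasing p \<longleftrightarrow>
     (\<forall>x1\<in>{0..1}. \<forall>x2\<in>{0..1}. x1 < x2 \<longrightarrow> (\<forall>y1\<in>p x1. \<forall>y2\<in>p x2. y1 \<ge> y2))"

definition sv_symmetric :: "(real \<Rightarrow> real set) \<Rightarrow> bool" where
  "sv_symmetric p \<longleftrightarrow> (\<forall>x\<in>{0..1}. \<forall>y\<in>{0..1}. y \<in> p x \<longleftrightarrow> x \<in> p y)"

definition sv_surjective :: "(real \<Rightarrow> real set) \<Rightarrow> bool" where
  "sv_surjective p \<longleftrightarrow> (\<forall>y\<in>{0..1}. \<exists>x\<in>{0..1}. y \<in> p x)"

definition sv_graph :: "(real \<Rightarrow> real set) \<Rightarrow> (real \<times> real) set" where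
  "sv_graph p = {(x, y). (x, y) \<in> unit_square \<and> y \<in> p x}"

end

theory Submission
  imports Defs
begin

text \<open>
  Let \<open>e\<close> be the neutral element. The proof rests on one observation: all discontinuities of \<open>U\<close>
  lie on the border between \<open>{U < e}\<close> and \<open>{U > e}\<close>. Suppose \<open>U a b = w > e\<close>. The t-conorm part
  of \<open>U\<close> is continuous, so every \<open>c \<in> [w, 1]\<close> is \<open>U z w\<close> for some \<open>z \<ge> e\<close>. By associativity
  \<open>c = U z (U a b) = U a (U z b)\<close>, so \<open>U a\<close> takes the value \<open>c\<close> at a point of \<open>[b, 1]\<close>. Hence
  the monotone map \<open>U a\<close> skips no value on \<open>[b, 1]\<close> and is continuous there. The same holds for
  all sections through the rectangle \<open>[a, 1] \<times> [b, 1]\<close>, and a function that is monotone and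
  continuous in each variable is jointly continuous
  (\<open>uninorm_continuous_above\<close>). Passing to the dual uninorm \<open>1 - U (1 - x) (1 - y)\<close> gives
  continuity on \<open>[0, a] \<times> [0, b]\<close> whenever \<open>U a b < e\<close> (\<open>uninorm_continuous_below\<close>).

  The graph \<open>R\<close> therefore only has to contain every point that is neither strictly
  above-right of a point with \<open>U > e\<close> nor strictly below-left of a point with \<open>U < e\<close>; the set
  of exactly these points is \<open>neutral_border\<close>. It is symmetric because \<open>U\<close> is. It is
  non-increasing because two of its points, one strictly above-right of the other, would enclose
  an open rectangle on which \<open>U = e\<close>, although inverses with respect to \<open>U\<close> are unique. It is
  surjective because in each row the border is met at the supremum of the arguments at which the
  row is not yet strictly above-right of a point with \<open>U > e\<close>; at the edges of the square one of the two
  conditions becomes vacuous, and this is what supplies points in rows where \<open>U\<close> does not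
  cross the value \<open>e\<close>.
\<close>

section \<open>Monotone functions and joint continuity\<close>

text \<open>
  Monotone functions only have jump discontinuities, and a jump skips values.
\<close>

lemma mono_on_skipping_no_value_continuous_on:
  fixes g :: "real \<Rightarrow> real"
  assumes mono: "mono_on {c..d} g"
    and ivp: "\<And>v. g c \<le> v \<Longrightarrow> v \<le> g d \<Longrightarrow> \<exists>y\<in>{c..d}. g y = v"
  shows "continuous_on {c..d} g"
proof (unfold continuous_on_iff, intro ballI allI impI)
  fix y and \<epsilon> :: real
  assume y: "y \<in> {c..d}" and eps: "0 < \<epsilon>"
  have cd: "c \<in> {c..d}" "d \<in> {c..d}" using y by auto
  note le = mono_onD[OF mono]
  have less: "s < t" if "s \<in> {c..d}" "t \<in> {c..d}" "g s < g t" for s t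
    using le[of t s] that by fastforce
  have "\<exists>\<delta>>0. \<forall>t\<in>{c..d}. y - \<delta> < t \<longrightarrow> g y - \<epsilon> < g t"
  proof (cases "g y - \<epsilon> / 2 < g c")
    case True
    then show ?thesis
      using eps le[OF cd(1)] by (intro exI[of _ 1]) fastforce
  next
    case False
    moreover have "g y \<le> g d" using le[OF y cd(2)] y by simp
    ultimately obtain u where u: "u \<in> {c..d}" "g u = g y - \<epsilon> / 2"
      using ivp[of "g y - \<epsilon> / 2"] eps by auto
    then have "u < y" using less[OF u(1) y] eps by simp
    moreover have "g y - \<epsilon> < g t" if "t \<in> {c..d}" "u < t" for t
      using le[OF u(1) that(1)] that u eps by simp
    ultimately show ?thesis by (intro exI[of _ "y - u"]) simp
  qed
  moreover have "\<exists>\<delta>>0. \<forall>t\<in>{c..d}. t < y + \<delta> \<longrightarrow> g t < g y + \<epsilon>"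
  proof (cases "g d < g y + \<epsilon> / 2")
    case True
    then show ?thesis
      using eps le[OF _ cd(2)] by (intro exI[of _ 1]) fastforce
  next
    case False
    moreover have "g c \<le> g y" using le[OF cd(1) y] y by simp
    ultimately obtain u where u: "u \<in> {c..d}" "g u = g y + \<epsilon> / 2"
      using ivp[of "g y + \<epsilon> / 2"] eps by auto
    then have "y < u" using less[OF y u(1)] eps by simp
    moreover have "g t < g y + \<epsilon>" if "t \<in> {c..d}" "t < u" for t
      using le[OF that(1) u(1)] that u eps by simp
    ultimately show ?thesis by (intro exI[of _ "u - y"]) simp
  qed
  ultimately obtain \<delta>1 \<delta>2 where
    "\<delta>1 > 0" "\<And>t. t \<in> {c..d} \<Longrightarrow> y - \<delta>1 < t \<Longrightarrow> g y - \<epsilon> < g t"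
    "\<delta>2 > 0" "\<And>t. t \<in> {c..d} \<Longrightarrow> t < y + \<delta>2 \<Longrightarrow> g t < g y + \<epsilon>"
    by blast
  then show "\<exists>\<delta>>0. \<forall>t\<in>{c..d}. dist t y < \<delta> \<longrightarrow> dist (g t) (g y) < \<epsilon>"
    by (intro exI[of _ "min \<delta>1 \<delta>2"]) (auto simp: dist_real_def abs_less_iff algebra_simps)
qed

text \<open>
  Comparison points on either side let monotonicity turn continuity of a section into bounds on
  a whole neighbourhood; at an end of the interval the comparison point is that end itself.
\<close>

lemma continuous_on_comparison_points:
  fixes g :: "real \<Rightarrow> real"
  assumes "continuous_on {c..d} g" and y: "y \<in> {c..d}" and eps: "0 < \<epsilon>"
  obtains \<delta> u v where "0 < \<delta>" "u \<in> {c..d}" "v \<in> {c..d}" "g y - \<epsilon> < g u" "g v < g y + \<epsilon>"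
    "\<forall>t\<in>{c..d}. \<bar>t - y\<bar> < \<delta> \<longrightarrow> u \<le> t \<and> t \<le> v"
proof -
  obtain \<delta> where \<delta>: "\<delta> > 0" "\<And>t. t \<in> {c..d} \<Longrightarrow> \<bar>t - y\<bar> < \<delta> \<Longrightarrow> \<bar>g t - g y\<bar> < \<epsilon>"
    using assms unfolding continuous_on_iff dist_real_def by blast
  let ?u = "max c (y - \<delta> / 2)" and ?v = "min d (y + \<delta> / 2)"
  have uv: "?u \<in> {c..d}" "?v \<in> {c..d}" using y \<delta>(1) by auto
  have "\<bar>?u - y\<bar> < \<delta>" "\<bar>?v - y\<bar> < \<delta>" using y \<delta>(1) by auto
  then have "\<bar>g ?u - g y\<bar> < \<epsilon>" "\<bar>g ?v - g y\<bar> < \<epsilon>" using \<delta>(2) uv by blast+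
  moreover have "?u \<le> t \<and> t \<le> ?v" if "t \<in> {c..d}" "\<bar>t - y\<bar> < \<delta> / 2" for t
  proof -
    have "t - y < \<delta> / 2" "- (t - y) < \<delta> / 2" using that(2) by (simp_all only: abs_less_iff)
    then have "y - \<delta> / 2 \<le> t" "t \<le> y + \<delta> / 2" by linarith+
    then show ?thesis using that(1) by simp
  qed
  ultimately show thesis
    using \<delta>(1) uv by (intro that[of "\<delta> / 2" ?u ?v]) auto
qed

lemma mono_separately_continuous_on_rectangle:
  fixes f :: "real \<Rightarrow> real \<Rightarrow> real"
  assumes mono1: "\<And>y. y \<in> {c..d} \<Longrightarrow> mono_on {a..b} (\<lambda>x. f x y)"
    and mono2: "\<And>x. x \<in> {a..b} \<Longrightarrow> mono_on {c..d} (f x)"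
    and cont1: "\<And>y. y \<in> {c..d} \<Longrightarrow> continuous_on {a..b} (\<lambda>x. f x y)"
    and cont2: "\<And>x. x \<in> {a..b} \<Longrightarrow> continuous_on {c..d} (f x)"
  shows "continuous_on ({a..b} \<times> {c..d}) (\<lambda>(x, y). f x y)"
proof (unfold continuous_on_iff, intro ballI allI impI)
  fix p and \<epsilon> :: real
  assume "p \<in> {a..b} \<times> {c..d}" and eps: "0 < \<epsilon>"
  then obtain x y where p: "p = (x, y)" and x: "x \<in> {a..b}" and y: "y \<in> {c..d}" by auto
  have eps2: "0 < \<epsilon> / 2" using eps by simp
  have le: "f s t \<le> f s' t'"
    if "s \<in> {a..b}" "s' \<in> {a..b}" "t \<in> {c..d}" "t' \<in> {c..d}" "s \<le> s'" "t \<le> t'" for s s' t t'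
    using mono_onD[OF mono1[OF that(3)] that(1,2,5)] mono_onD[OF mono2[OF that(2)] that(3,4,6)]
    by simp
  obtain \<delta> u v where \<delta>: "0 < \<delta>" and u: "u \<in> {c..d}" and v: "v \<in> {c..d}"
    and fu: "f x y - \<epsilon> / 2 < f x u" and fv: "f x v < f x y + \<epsilon> / 2"
    and uv: "\<forall>t\<in>{c..d}. \<bar>t - y\<bar> < \<delta> \<longrightarrow> u \<le> t \<and> t \<le> v"
    by (rule continuous_on_comparison_points[OF cont2[OF x] y eps2])
  obtain \<delta>1 u1 v1 where \<delta>1: "0 < \<delta>1" and u1: "u1 \<in> {a..b}"
    and fu1: "f x u - \<epsilon> / 2 < f u1 u"
    and uv1: "\<forall>t\<in>{a..b}. \<bar>t - x\<bar> < \<delta>1 \<longrightarrow> u1 \<le> t \<and> t \<le> v1"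
    by (rule continuous_on_comparison_points[OF cont1[OF u] x eps2])
  obtain \<delta>2 u2 v2 where \<delta>2: "0 < \<delta>2" and v2: "v2 \<in> {a..b}"
    and fv2: "f v2 v < f x v + \<epsilon> / 2"
    and uv2: "\<forall>t\<in>{a..b}. \<bar>t - x\<bar> < \<delta>2 \<longrightarrow> u2 \<le> t \<and> t \<le> v2"
    by (rule continuous_on_comparison_points[OF cont1[OF v] x eps2])
  have "\<bar>f s t - f x y\<bar> < \<epsilon>"
    if s: "s \<in> {a..b}" and t: "t \<in> {c..d}"
      and near: "dist (s, t) (x, y) < min \<delta> (min \<delta>1 \<delta>2)" for s t
  proof -
    have "dist s x < min \<delta> (min \<delta>1 \<delta>2)" "dist t y < min \<delta> (min \<delta>1 \<delta>2)"
      using near dist_fst_le[of "(s, t)" "(x, y)"] dist_snd_le[of "(s, t)" "(x, y)"]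
      by (auto intro: le_less_trans)
    then have "u1 \<le> s" "s \<le> v2" "u \<le> t" "t \<le> v"
      using uv t uv1 uv2 s by (auto simp: dist_real_def)
    then have "f u1 u \<le> f s t" "f s t \<le> f v2 v"
      using le u1 v2 u v s t by auto
    then show ?thesis using fu fv fu1 fv2 by linarith
  qed
  then show "\<exists>\<delta>>0. \<forall>q\<in>{a..b} \<times> {c..d}. dist q p < \<delta> \<longrightarrow>
      dist ((\<lambda>(x, y). f x y) q) ((\<lambda>(x, y). f x y) p) < \<epsilon>"
    using \<delta> \<delta>1 \<delta>2 unfolding p
    by (intro exI[of _ "min \<delta> (min \<delta>1 \<delta>2)"]) (auto simp: dist_real_def)
qed

section \<open>Uninorms and their duals\<close>

lemma uninorm_withD:
  assumes "uninorm_with U e"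
  shows "x \<in> {0..1} \<Longrightarrow> y \<in> {0..1} \<Longrightarrow> U x y \<in> {0..1}"
    and "x \<in> {0..1} \<Longrightarrow> y \<in> {0..1} \<Longrightarrow> U x y = U y x"
    and "x \<in> {0..1} \<Longrightarrow> y \<in> {0..1} \<Longrightarrow> z \<in> {0..1} \<Longrightarrow> U (U x y) z = U x (U y z)"
    and "x \<in> {0..1} \<Longrightarrow> mono_on {0..1} (U x)"
    and "0 < e" "e < 1"
    and "x \<in> {0..1} \<Longrightarrow> U e x = x"
  using assms unfolding uninorm_with_def by (blast | auto)+

lemma uninorm_with_mono:
  assumes U: "uninorm_with U e"
    and "x \<in> {0..1}" "x' \<in> {0..1}" "y \<in> {0..1}" "y' \<in> {0..1}" "x \<le> x'" "y \<le> y'"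
  shows "U x y \<le> U x' y'"
  using mono_onD[OF uninorm_withD(4)[OF U, of y] _ _ \<open>x \<le> x'\<close>]
    mono_onD[OF uninorm_withD(4)[OF U, of x'] _ _ \<open>y \<le> y'\<close>]
    uninorm_withD(2)[OF U] assms by fastforce

lemma uninorm_with_inverse_unique:
  assumes U: "uninorm_with U e"
    and "x \<in> {0..1}" "y \<in> {0..1}" "z \<in> {0..1}" "U x y = e" "U x z = e"
  shows "y = z"
proof -
  have "y = U e y" using uninorm_withD(7)[OF U] assms by simp
  also have "\<dots> = U (U z x) y" using uninorm_withD(2)[OF U] assms by metis
  also have "\<dots> = U z (U x y)" using uninorm_withD(3)[OF U] assms by simp
  also have "\<dots> = U e z" using uninorm_withD(2)[OF U, of z e] uninorm_withD(5,6)[OF U] assms by simp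
  also have "\<dots> = z" using uninorm_withD(7)[OF U] assms by simp
  finally show ?thesis .
qed

definition dual_uninorm :: "(real \<Rightarrow> real \<Rightarrow> real) \<Rightarrow> real \<Rightarrow> real \<Rightarrow> real" where
  "dual_uninorm U x y = 1 - U (1 - x) (1 - y)"

lemma uninorm_with_dual:
  assumes U: "uninorm_with U e"
  shows "uninorm_with (dual_uninorm U) (1 - e)"
proof -
  note D = uninorm_withD[OF U]
  have m: "1 - U (1 - x) (1 - y) \<le> 1 - U (1 - x') (1 - y')"
    if "x \<in> {0..1}" "x' \<in> {0..1}" "y \<in> {0..1}" "y' \<in> {0..1}" "x \<le> x'" "y \<le> y'" for x x' y y'
    using uninorm_with_mono[OF U, of "1 - x'" "1 - x" "1 - y'" "1 - y"] that by auto
  show ?thesis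
    unfolding uninorm_with_def
  proof (intro conjI ballI)
    fix x y :: real assume "x \<in> {0..1}" "y \<in> {0..1}"
    then have *: "1 - x \<in> {0..1}" "1 - y \<in> {0..1}" by auto
    show "dual_uninorm U x y \<in> {0..1}" using D(1)[OF *] by (simp add: dual_uninorm_def)
    show "dual_uninorm U x y = dual_uninorm U y x" using D(2)[OF *] by (simp add: dual_uninorm_def)
  next
    fix x y z :: real assume "x \<in> {0..1}" "y \<in> {0..1}" "z \<in> {0..1}"
    then have *: "1 - x \<in> {0..1}" "1 - y \<in> {0..1}" "1 - z \<in> {0..1}" by auto
    show "dual_uninorm U (dual_uninorm U x y) z = dual_uninorm U x (dual_uninorm U y z)"
      using D(3)[OF *] by (simp add: dual_uninorm_def)
  next
    fix x :: real assume x: "x \<in> {0..1}"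
    show "mono_on {0..1} (\<lambda>y. dual_uninorm U x y)" "mono_on {0..1} (\<lambda>y. dual_uninorm U y x)"
      using x m by (auto intro!: mono_onI simp: dual_uninorm_def)
    show "dual_uninorm U (1 - e) x = x"
      using D(7)[of "1 - x"] x by (simp add: dual_uninorm_def)
  next
    show "1 - e \<in> {0<..<1}" using D(5,6) by simp
  qed
qed

section \<open>Continuity away from the value of the neutral element\<close>

text \<open>
  Once a section of \<open>U\<close> has reached a value \<open>w > e\<close>, it attains every larger value up to \<open>1\<close>:
  by associativity, combining the argument with \<open>z\<close> combines the value with \<open>z\<close>, and the
  values \<open>U z w\<close> with \<open>z \<in> [e, 1]\<close> fill \<open>[w, 1]\<close>. The hypothesis speaks of sections of \<open>U\<close>
  rather than of the t-conorm so that the lemma applies verbatim to the dual uninorm, whose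
  sections on \<open>[1 - e, 1]\<close> are reflected sections of the t-norm part.
\<close>

lemma uninorm_continuous_above:
  assumes U: "uninorm_with U e"
    and cont: "\<And>w. w \<in> {e..1} \<Longrightarrow> continuous_on {e..1} (\<lambda>z. U z w)"
    and a: "a \<in> {0..1}" and b: "b \<in> {0..1}" and ab: "e < U a b"
  shows "continuous_on ({a..1} \<times> {b..1}) (\<lambda>(x, y). U x y)"
proof -
  note D = uninorm_withD[OF U]
  \<comment> \<open>Stated for arbitrary \<open>p\<close> and \<open>q\<close>: by commutativity it serves both directions of the rectangle.\<close>
  have section_cont: "continuous_on {q..1} (U p)"
    if p: "p \<in> {0..1}" and q: "q \<in> {0..1}" and pq: "e < U p q" for p q
  proof (rule mono_on_skipping_no_value_continuous_on)
    show "mono_on {q..1} (U p)"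
      using D(4)[OF p] q by (auto intro: mono_on_subset)
  next
    fix v assume v: "U p q \<le> v" "v \<le> U p 1"
    let ?w = "U p q"
    have w: "?w \<in> {0..1}" "?w \<in> {e..1}" using D(1)[OF p q] pq by auto
    have "U e 1 \<le> U 1 ?w"
      using uninorm_with_mono[OF U, of e ?w 1 1] D(2)[of 1 ?w] D(5,6) w by simp
    then have "v \<le> U 1 ?w"
      using v(2) D(1)[OF p, of 1] D(7)[of 1] by simp
    moreover have "U e ?w \<le> v" using D(7)[OF w(1)] v(1) by simp
    ultimately obtain z where z: "z \<in> {e..1}" "U z ?w = v"
      using IVT'[of "\<lambda>z. U z ?w" e v 1] cont[OF w(2)] D(6) by auto
    have z01: "z \<in> {0..1}" using z(1) D(5) by simp
    have "U p (U z q) = U (U p z) q" using D(3)[OF p z01 q] by simp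
    also have "\<dots> = U z ?w" using D(2)[OF p z01] D(3)[OF z01 p q] by simp
    finally have "U p (U z q) = v" using z(2) by simp
    moreover have "U e q \<le> U z q"
      using uninorm_with_mono[OF U, of e z q q] z z01 q D(5,6) by simp
    then have "U z q \<in> {q..1}" using D(7)[OF q] D(1)[OF z01 q] by simp
    ultimately show "\<exists>y\<in>{q..1}. U p y = v" by blast
  qed
  have above: "e < U x y" if "x \<in> {a..1}" "y \<in> {b..1}" for x y
    using uninorm_with_mono[OF U, of a x b y] that a b ab by auto
  have cont2: "continuous_on {b..1} (U x)" if "x \<in> {a..1}" for x
    using section_cont[of x b] above[OF that, of b] that a b by auto
  have comm: "U x y = U y x" if "x \<in> {a..1}" "y \<in> {b..1}" for x y
    using D(2) that a b by auto
  have cont1: "continuous_on {a..1} (\<lambda>x. U x y)" if y: "y \<in> {b..1}" for y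
  proof -
    have "continuous_on {a..1} (U y)"
      using section_cont[of y a] above[of a y] comm[of a y] y a b by auto
    moreover have "U y x = U x y" if "x \<in> {a..1}" for x using comm[OF that y] by simp
    ultimately show ?thesis by (rule continuous_on_eq)
  qed
  show ?thesis
    using uninorm_with_mono[OF U] a b cont1 cont2
    by (intro mono_separately_continuous_on_rectangle mono_onI) auto
qed

lemma uninorm_continuous_below:
  assumes U: "uninorm_with U e"
    and cont: "\<And>w. w \<in> {0..e} \<Longrightarrow> continuous_on {0..e} (\<lambda>z. U z w)"
    and a: "a \<in> {0..1}" and b: "b \<in> {0..1}" and ab: "U a b < e"
  shows "continuous_on ({0..a} \<times> {0..b}) (\<lambda>(x, y). U x y)"
proof -
  have "continuous_on ({1 - a..1} \<times> {1 - b..1}) (\<lambda>(x, y). dual_uninorm U x y)"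
  proof (rule uninorm_continuous_above[OF uninorm_with_dual[OF U]])
    fix w assume "w \<in> {1 - e..1}"
    then have w: "1 - w \<in> {0..e}" by auto
    have "continuous_on {1 - e..1} (\<lambda>z. U (1 - z) (1 - w))"
      by (rule continuous_on_compose2[OF cont[OF w]]) (auto intro!: continuous_intros)
    then show "continuous_on {1 - e..1} (\<lambda>z. dual_uninorm U z w)"
      unfolding dual_uninorm_def by (intro continuous_intros)
  qed (use a b ab in \<open>auto simp: dual_uninorm_def\<close>)
  then have "continuous_on ({0..a} \<times> {0..b})
      (\<lambda>p. (\<lambda>(x, y). dual_uninorm U x y) ((\<lambda>(x, y). (1 - x, 1 - y)) p))"
    by (rule continuous_on_compose2) (auto intro!: continuous_intros simp: case_prod_beta)
  then have "continuous_on ({0..a} \<times> {0..b})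
      (\<lambda>p. 1 - (\<lambda>(x, y). dual_uninorm U x y) ((\<lambda>(x, y). (1 - x, 1 - y)) p))"
    by (intro continuous_intros)
  then show ?thesis
    by (simp add: dual_uninorm_def case_prod_beta)
qed

lemma section_continuous_of_underlying_tnorm:
  assumes cont: "continuous_on unit_square (\<lambda>(x, y). underlying_tnorm U e x y)"
    and e: "0 < e" and w: "w \<in> {0..e}"
  shows "continuous_on {0..e} (\<lambda>z. U z w)"
proof -
  have "continuous_on {0..e} (\<lambda>z. (\<lambda>(x, y). underlying_tnorm U e x y) (z / e, w / e))"
    by (rule continuous_on_compose2[OF cont]) (use e w in \<open>auto intro!: continuous_intros\<close>)
  then have "continuous_on {0..e} (\<lambda>z. e * underlying_tnorm U e (z / e) (w / e))"
    by (auto intro!: continuous_intros)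
  then show ?thesis using e by (simp add: underlying_tnorm_def)
qed

lemma section_continuous_of_underlying_tconorm:
  assumes cont: "continuous_on unit_square (\<lambda>(x, y). underlying_tconorm U e x y)"
    and e: "e < 1" and w: "w \<in> {e..1}"
  shows "continuous_on {e..1} (\<lambda>z. U z w)"
proof -
  have "continuous_on {e..1}
      (\<lambda>z. (\<lambda>(x, y). underlying_tconorm U e x y) ((z - e) / (1 - e), (w - e) / (1 - e)))"
    by (rule continuous_on_compose2[OF cont]) (use e w in \<open>auto intro!: continuous_intros\<close>)
  then have "continuous_on {e..1}
      (\<lambda>z. e + (1 - e) * underlying_tconorm U e ((z - e) / (1 - e)) ((w - e) / (1 - e)))"
    by (auto intro!: continuous_intros)
  then show ?thesis using e by (simp add: underlying_tconorm_def)
qed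

section \<open>The border of the value of the neutral element\<close>

text \<open>
  The strict inequalities between arguments make the conditions vacuous at the edges of the
  square. The border thus acquires the boundary segments that surjectivity demands when \<open>U\<close>
  stays on one side of \<open>e\<close> along an edge.
\<close>

definition neutral_border :: "(real \<Rightarrow> real \<Rightarrow> real) \<Rightarrow> real \<Rightarrow> real \<Rightarrow> real set" where
  "neutral_border U e x = {y \<in> {0..1}.
     (\<forall>x'\<in>{0..<x}. \<forall>y'\<in>{0..<y}. U x' y' \<le> e) \<and>
     (\<forall>x'\<in>{x<..1}. \<forall>y'\<in>{y<..1}. e \<le> U x' y')}"

text \<open>
  On an open rectangle between two increasing points of the border both conditions apply and
  force \<open>U = e\<close>, so that one argument would have several inverses.
\<close>

lemma neutral_border_nonincreasing:
  assumes U: "uninorm_with U e"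
  shows "sv_nonincreasing (neutral_border U e)"
  unfolding sv_nonincreasing_def
proof (intro ballI impI, rule ccontr)
  fix x1 x2 y1 y2 :: real
  assume x: "x1 \<in> {0..1}" "x2 \<in> {0..1}" "x1 < x2"
    and y: "y1 \<in> neutral_border U e x1" "y2 \<in> neutral_border U e x2" and "\<not> y2 \<le> y1"
  then have y12: "y1 < y2" "y1 \<in> {0..1}" "y2 \<in> {0..1}" by (auto simp: neutral_border_def)
  obtain s where s: "x1 < s" "s < x2" using x dense by blast
  obtain t where t: "y1 < t" "t < y2" using y12 dense by blast
  obtain t' where t': "t < t'" "t' < y2" using t dense by blast
  have "U s q = e" if "y1 < q" "q < y2" for q
  proof (rule antisym)
    show "U s q \<le> e" "e \<le> U s q"
      using y s that x y12 by (auto simp: neutral_border_def)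
  qed
  then have "U s t = e" "U s t' = e" using t t' by auto
  then have "t = t'"
    using uninorm_with_inverse_unique[OF U, of s t t'] s t t' x y12 by auto
  then show False using t' by simp
qed

lemma neutral_border_surjective:
  assumes U: "uninorm_with U e"
  shows "sv_surjective (neutral_border U e)"
  unfolding sv_surjective_def
proof
  fix y :: real assume y: "y \<in> {0..1}"
  \<comment> \<open>The first condition of the border holds on a closed initial segment of the row, and the second
    one holds from the end of that segment on.\<close>
  define A where "A = {x \<in> {0..1}. \<forall>x'\<in>{0..<x}. \<forall>y'\<in>{0..<y}. U x' y' \<le> e}"
  have A: "0 \<in> A" "bdd_above A" unfolding A_def by (auto intro: bdd_aboveI)
  then have ne: "A \<noteq> {}" by blast
  define x where "x = Sup A"
  have x0: "0 \<le> x" unfolding x_def using A by (rule cSup_upper)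
  have x1: "x \<le> 1" unfolding x_def using ne by (rule cSup_least) (simp add: A_def)
  have "U x' y' \<le> e" if "x' \<in> {0..<x}" "y' \<in> {0..<y}" for x' y'
  proof -
    have "x' < Sup A" using that(1) unfolding x_def by simp
    then obtain a where "a \<in> A" "x' < a"
      using less_cSup_iff[OF ne A(2), of x'] by blast
    then have "x' \<in> {0..<a}" using that(1) by simp
    then show ?thesis using that(2) \<open>a \<in> A\<close> unfolding A_def by blast
  qed
  moreover have "e \<le> U x' y'" if x': "x' \<in> {x<..1}" and y': "y' \<in> {y<..1}" for x' y'
  proof -
    have "x' \<notin> A" using cSup_upper[OF _ A(2), of x'] x' unfolding x_def by auto
    then obtain p q where "p \<in> {0..<x'}" "q \<in> {0..<y}" "e < U p q"
      using x' x0 unfolding A_def by fastforce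
    then show ?thesis
      using uninorm_with_mono[OF U, of p x' q y'] x' y' x0 y by auto
  qed
  ultimately have "y \<in> neutral_border U e x"
    using y unfolding neutral_border_def by blast
  then show "\<exists>x\<in>{0..1}. y \<in> neutral_border U e x" using x0 x1 by auto
qed

lemma neutral_border_symmetric:
  assumes U: "uninorm_with U e"
  shows "sv_symmetric (neutral_border U e)"
proof -
  have comm: "U x' y' = U y' x'" if "x' \<in> {0..1}" "y' \<in> {0..1}" for x' y'
    using uninorm_withD(2)[OF U that] .
  have "x \<in> neutral_border U e y"
    if "x \<in> {0..1}" "y \<in> {0..1}" "y \<in> neutral_border U e x" for x y
  proof -
    have lower: "U x' y' \<le> e" if "x' \<in> {0..<x}" "y' \<in> {0..<y}" for x' y'
      using that \<open>y \<in> neutral_border U e x\<close> unfolding neutral_border_def by blast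
    have upper: "e \<le> U x' y'" if "x' \<in> {x<..1}" "y' \<in> {y<..1}" for x' y'
      using that \<open>y \<in> neutral_border U e x\<close> unfolding neutral_border_def by blast
    have "U y' x' \<le> e" if "x' \<in> {0..<x}" "y' \<in> {0..<y}" for x' y'
      using lower[OF that] comm[of x' y'] that \<open>x \<in> {0..1}\<close> \<open>y \<in> {0..1}\<close> by simp
    moreover have "e \<le> U y' x'" if "x' \<in> {x<..1}" "y' \<in> {y<..1}" for x' y'
      using upper[OF that] comm[of x' y'] that \<open>x \<in> {0..1}\<close> \<open>y \<in> {0..1}\<close> by simp
    ultimately show ?thesis using \<open>x \<in> {0..1}\<close> unfolding neutral_border_def by blast
  qed
  then show ?thesis unfolding sv_symmetric_def by blast
qed

lemma uninorm_continuous_off_neutral_border: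
  assumes U: "uninorm_with U e"
    and T: "continuous_on unit_square (\<lambda>(x, y). underlying_tnorm U e x y)"
    and S: "continuous_on unit_square (\<lambda>(x, y). underlying_tconorm U e x y)"
  shows "continuous_at_points_of (unit_square - sv_graph (neutral_border U e)) U"
  unfolding continuous_at_points_of_def
proof
  fix p assume "p \<in> unit_square - sv_graph (neutral_border U e)"
  then obtain x y where p: "p = (x, y)" and x: "x \<in> {0..1}" and y: "y \<in> {0..1}"
    and off: "y \<notin> neutral_border U e x"
    unfolding sv_graph_def by blast
  note D = uninorm_withD[OF U]
  \<comment> \<open>The rectangles on which \<open>U\<close> is continuous are neighbourhoods of \<open>p\<close> relative to the square.\<close>
  have local: "continuous (at p within unit_square) (\<lambda>(x, y). U x y)"
    if "continuous_on R (\<lambda>(x, y). U x y)" "p \<in> W" "open W" "W \<inter> unit_square \<subseteq> R" "R \<subseteq> unit_square"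
    for R W :: "(real \<times> real) set"
  proof -
    have "continuous (at p within R) (\<lambda>(x, y). U x y)"
      using that x y p unfolding continuous_on_eq_continuous_within by auto
    moreover have "at p within R = at p within unit_square"
      using that by (intro at_within_nhd[of p W]) auto
    ultimately show ?thesis by simp
  qed
  from off y consider
      (above) a b where "a \<in> {0..<x}" "b \<in> {0..<y}" "e < U a b"
    | (below) a b where "a \<in> {x<..1}" "b \<in> {y<..1}" "U a b < e"
    unfolding neutral_border_def by fastforce
  then show "continuous (at p within unit_square) (\<lambda>(x, y). U x y)"
  proof cases
    case above
    have "continuous_on ({a..1} \<times> {b..1}) (\<lambda>(x, y). U x y)"
      by (rule uninorm_continuous_above[OF U section_continuous_of_underlying_tconorm[OF S D(6)]])
         (use above x y in auto)
    then show ?thesis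
      by (rule local[where W = "{a<..} \<times> {b<..}"])
         (use above x y p in \<open>auto intro!: open_Times\<close>)
  next
    case below
    have "continuous_on ({0..a} \<times> {0..b}) (\<lambda>(x, y). U x y)"
      by (rule uninorm_continuous_below[OF U section_continuous_of_underlying_tnorm[OF T D(5)]])
         (use below x y in auto)
    then show ?thesis
      by (rule local[where W = "{..<a} \<times> {..<b}"])
         (use below x y p in \<open>auto intro!: open_Times\<close>)
  qed
qed

section \<open>The set of discontinuity points\<close>

theorem theorem2:
  fixes U :: "real \<Rightarrow> real \<Rightarrow> real"
  assumes "uninorm U" and "U \<in> uninorms_cont_underlying"
  shows "\<exists>r :: real \<Rightarrow> real set.
    set_valued_function r \<and> sv_symmetric r \<and> sv_surjective r \<and> sv_nonincreasing r \<and>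
    continuous_at_points_of (unit_square - sv_graph r) U"
proof -
  obtain e where U: "uninorm_with U e"
    and "continuous_on unit_square (\<lambda>(x, y). underlying_tnorm U e x y)"
    and "continuous_on unit_square (\<lambda>(x, y). underlying_tconorm U e x y)"
    using assms(2) unfolding uninorms_cont_underlying_def by blast
  then have "continuous_at_points_of (unit_square - sv_graph (neutral_border U e)) U"
    by (rule uninorm_continuous_off_neutral_border)
  moreover have "set_valued_function (neutral_border U e)"
    by (auto simp: set_valued_function_def neutral_border_def)
  ultimately show ?thesis
    using neutral_border_symmetric[OF U] neutral_border_surjective[OF U]
      neutral_border_nonincreasing[OF U] by blast
qed

end
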